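(* For every integer $n\ge 1$, $$\sum_{m=0}^{\lfloor (n-1)/2\rfloor}\frac{1}{(n-m)\binom{n-m-1}{m}}=\sum_{i=1}^{n}\frac{F_i\bigl((-1)^n+2(-1)^{i-1}\bigr)}{n-i+1}.$$
   Context: $F_i$ is the $i$-th Fibonacci number, with $F_0=0$, $F_1=F_2=1$ and $F_{i+2}=F_{i+1}+F_i$. *)

theory Defs
  imports Complex_Main "HOL-Number_Theory.Fib"
begin

end

theory Submission
  imports Defs
begin

text \<open>
  The summands on the left are the entries of the Leibniz harmonic triangle, the array
  \<open>1 / ((N + 1) * (N choose m))\<close> in which each entry is the sum of the two entries below it.
  The left-hand side adds them along a shallow diagonal, just as Fibonacci numbers arise from
  the shallow diagonals of Pascal's triangle. Splitting every entry of diagonal \<open>n\<close> into its two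
  children yields the diagonals \<open>n + 1\<close> and \<open>n + 2\<close>, up to one or two boundary entries, and so
  \<open>L (n + 2) = L n - L (n + 1) + (2 + (-1) ^ n) / (n + 2)\<close> (lemma \<open>diagonal_sum_recurrence\<close>).

  The right-hand side is a combination of two convolutions with the harmonic
  sequence, one of \<open>fib i\<close> and one of \<open>(-1) ^ i * fib i\<close>. A convolution inherits the linear
  recurrence of its first factor, with an inhomogeneous term coming from its initial value
  (lemma \<open>harmonic_convolution_recurrence\<close>). Multiplying the first convolution by \<open>(-1) ^ n\<close> turns the
  recurrence \<open>x\<^sup>2 = x + 1\<close> into \<open>x\<^sup>2 = 1 - x\<close>, the one of the second, and the inhomogeneous
  terms add up to \<open>(2 + (-1) ^ n) / (n + 2)\<close>. Both sides therefore satisfy one recurrence of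
  order two, with equal starting values at \<open>0\<close> and \<open>1\<close>.
\<close>

definition leibniz_triangle :: "nat \<Rightarrow> nat \<Rightarrow> real" where
  "leibniz_triangle N m = 1 / (real (N + 1) * real (N choose m))"

text \<open>
  Both children are explicit multiples of the parent: by the absorption identities
  \<open>(N + 1 - m) * ((N + 1) choose m) = (N + 1) * (N choose m)\<close> and
  \<open>(m + 1) * ((N + 1) choose (m + 1)) = (N + 1) * (N choose m)\<close>, the factors are
  \<open>(N + 1 - m) / (N + 2)\<close> and \<open>(m + 1) / (N + 2)\<close>, which add up to \<open>1\<close>.
\<close>

lemma leibniz_triangle_rule:
  assumes "m \<le> N"
  shows "leibniz_triangle N m = leibniz_triangle (Suc N) m + leibniz_triangle (Suc N) (Suc m)"
proof -
  define b where "b = real (N choose m)"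
  define c where "c = real (Suc N choose m)"
  define d where "d = real (Suc N choose Suc m)"
  have pos: "b > 0" "c > 0" "d > 0"
    using assms by (simp_all add: b_def c_def d_def del: binomial_Suc_Suc)
  have "(Suc N - m) * (Suc N choose m) = Suc N * (N choose m)"
    using binomial_absorb_comp[of "Suc N" m] by simp
  then have "real (Suc N - m) * c = real (Suc N) * b"
    unfolding b_def c_def of_nat_mult [symmetric] by (rule arg_cong)
  then have c: "(real N + 1 - real m) * c = (real N + 1) * b"
    using assms by (simp add: add.commute)
  have "Suc m * (Suc N choose Suc m) = Suc N * (N choose m)"
    by (rule Suc_times_binomial)
  then have "real (Suc m) * d = real (Suc N) * b"
    unfolding b_def d_def of_nat_mult [symmetric] by (rule arg_cong)
  then have d: "(real m + 1) * d = (real N + 1) * b"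
    by (simp add: algebra_simps)
  have "1 / c = (real N + 1 - real m) / ((real N + 1) * b)"
    using pos assms by (simp add: c [symmetric])
  moreover have "1 / d = (real m + 1) / ((real N + 1) * b)"
    using pos by (simp add: d [symmetric])
  ultimately have "1 / c + 1 / d = (real N + 2) / ((real N + 1) * b)"
    by (simp add: add_divide_distrib [symmetric])
  then have "(1 / c + 1 / d) / (real N + 2) = 1 / ((real N + 1) * b)"
    by simp
  then show ?thesis
    by (simp add: leibniz_triangle_def b_def c_def d_def add_divide_distrib algebra_simps
        del: binomial_Suc_Suc)
qed

text \<open>
  The index set is written so that diagonal \<open>0\<close> is empty, which makes the recurrence
  hold from \<open>n = 0\<close> on.
\<close>

definition diagonal_sum :: "nat \<Rightarrow> real" where
  "diagonal_sum n = (\<Sum>m | 2 * m < n. leibniz_triangle (n - 1 - m) m)"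

lemma finite_diagonal: "finite {m :: nat. 2 * m < n}"
  by (rule finite_subset[of _ "{..n}"]) auto

text \<open>
  The left children of diagonal \<open>n\<close> miss diagonal \<open>n + 1\<close> only in the entry on the right edge
  of the triangle, which occurs for even \<open>n\<close>; the right children miss diagonal \<open>n + 2\<close> only in the
  entry on the left edge.
\<close>

lemma diagonal_sum_recurrence:
  "diagonal_sum (n + 2) = diagonal_sum n - diagonal_sum (n + 1) + (2 + (-1) ^ n) / real (n + 2)"
proof -
  let ?D = "{m. 2 * m < n}"
  let ?left = "\<Sum>m\<in>?D. leibniz_triangle (n - m) m"
  let ?right = "\<Sum>m\<in>?D. leibniz_triangle (n - m) (Suc m)"
  have split: "diagonal_sum n = ?left + ?right"
    unfolding diagonal_sum_def sum.distrib [symmetric]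
  proof (rule sum.cong)
    fix m assume "m \<in> ?D"
    then have "Suc (n - 1 - m) = n - m" "m \<le> n - 1 - m"
      by auto
    then show "leibniz_triangle (n - 1 - m) m
      = leibniz_triangle (n - m) m + leibniz_triangle (n - m) (Suc m)"
      by (metis leibniz_triangle_rule)
  qed simp
  have "{m. 2 * m < n + 2} = insert 0 (Suc ` ?D)"
  proof (intro set_eqI iffI)
    fix m assume "m \<in> {m. 2 * m < n + 2}"
    then show "m \<in> insert 0 (Suc ` ?D)"
      by (cases m) auto
  qed auto
  then have right: "diagonal_sum (n + 2) = 1 / real (n + 2) + ?right"
    using finite_diagonal
    by (simp add: diagonal_sum_def sum.reindex leibniz_triangle_def [of "Suc n" 0])
  have left: "diagonal_sum (n + 1) = ?left + (if even n then 2 / real (n + 2) else 0)"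
  proof (cases "even n")
    case True
    then obtain k where k: "n = 2 * k"
      by (elim evenE)
    then have "{m. 2 * m < n + 1} = insert k ?D"
      by auto
    moreover have "leibniz_triangle (n - k) k = 2 / real (n + 2)"
      by (simp add: k leibniz_triangle_def field_simps)
    ultimately show ?thesis
      using True finite_diagonal k by (simp add: diagonal_sum_def)
  next
    case False
    then have "{m. 2 * m < n + 1} = ?D"
      by (intro Collect_cong) presburger
    then show ?thesis
      using False by (simp add: diagonal_sum_def)
  qed
  show ?thesis
    unfolding left right split by (auto simp: add_divide_distrib)
qed

definition harmonic_convolution :: "(nat \<Rightarrow> real) \<Rightarrow> nat \<Rightarrow> real" where
  "harmonic_convolution f n = (\<Sum>i\<le>n. f i / real (n - i + 1))"

lemma harmonic_convolution_recurrence: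
  assumes "f 0 = 0" and "\<And>i. f (i + 2) = c * f (i + 1) + f i"
  shows "harmonic_convolution f (n + 2)
    = c * harmonic_convolution f (n + 1) + harmonic_convolution f n + f 1 / real (n + 2)"
proof -
  have "harmonic_convolution f (n + 2)
      = f 1 / real (n + 2) + (\<Sum>i\<le>n. f (i + 2) / real (n - i + 1))"
    by (simp add: harmonic_convolution_def sum.atMost_Suc_shift assms(1) del: sum.atMost_Suc)
  moreover have "harmonic_convolution f (n + 1) = (\<Sum>i\<le>n. f (i + 1) / real (n - i + 1))"
    by (simp add: harmonic_convolution_def sum.atMost_Suc_shift assms(1) del: sum.atMost_Suc)
  ultimately show ?thesis
    unfolding assms(2)
    by (simp add: harmonic_convolution_def add_divide_distrib sum.distrib sum_distrib_left)
qed

lemma diagonal_sum_eq_harmonic_convolution: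
  "diagonal_sum n = (-1) ^ n * harmonic_convolution (\<lambda>i. real (fib i)) n
     - 2 * harmonic_convolution (\<lambda>i. (-1) ^ i * real (fib i)) n"
proof (induction n rule: fib.induct)
  case 1
  show ?case
    by (simp add: diagonal_sum_def harmonic_convolution_def)
next
  case 2
  have "{m :: nat. 2 * m < Suc 0} = {0}"
    by auto
  then show ?case
    by (simp add: diagonal_sum_def harmonic_convolution_def leibniz_triangle_def)
next
  case (3 n)
  have "harmonic_convolution (\<lambda>i. real (fib i)) (n + 2)
      = harmonic_convolution (\<lambda>i. real (fib i)) (n + 1)
        + harmonic_convolution (\<lambda>i. real (fib i)) n + 1 / real (n + 2)"
    using harmonic_convolution_recurrence [of "\<lambda>i. real (fib i)" 1 n] by simp
  moreover have "harmonic_convolution (\<lambda>i. (-1) ^ i * real (fib i)) (n + 2)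
      = - harmonic_convolution (\<lambda>i. (-1) ^ i * real (fib i)) (n + 1)
        + harmonic_convolution (\<lambda>i. (-1) ^ i * real (fib i)) n - 1 / real (n + 2)"
    using harmonic_convolution_recurrence [of "\<lambda>i. (-1) ^ i * real (fib i)" "-1" n]
    by (simp add: algebra_simps)
  ultimately show ?case
    using 3 diagonal_sum_recurrence [of n] by (simp add: algebra_simps add_divide_distrib)
qed

theorem theorem6p2:
  fixes n :: nat
  assumes "n \<ge> 1"
  shows "(\<Sum>m = 0..(n - 1) div 2. 1 / (real (n - m) * real ((n - m - 1) choose m)))
       = (\<Sum>i = 1..n. real (fib i) * ((-1) ^ n + 2 * (-1) ^ (i - 1)) / real (n - i + 1))"
proof -
  have "{0..(n - 1) div 2} = {m. 2 * m < n}"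
    using assms by auto
  then have "(\<Sum>m = 0..(n - 1) div 2. 1 / (real (n - m) * real ((n - m - 1) choose m)))
      = diagonal_sum n"
    unfolding diagonal_sum_def leibniz_triangle_def
  proof (rule sum.cong)
    fix m assume "m \<in> {m. 2 * m < n}"
    then have "n - m = n - 1 - m + 1" "n - m - 1 = n - 1 - m"
      by auto
    then show "1 / (real (n - m) * real ((n - m - 1) choose m))
      = 1 / (real (n - 1 - m + 1) * real ((n - 1 - m) choose m))"
      by (simp only:)
  qed
  also have "\<dots> = (\<Sum>i\<le>n. (-1) ^ n * (real (fib i) / real (n - i + 1))
      - 2 * ((-1) ^ i * real (fib i) / real (n - i + 1)))"
    by (simp only: diagonal_sum_eq_harmonic_convolution harmonic_convolution_def
        sum_distrib_left sum_subtractf)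
  also have "\<dots> = (\<Sum>i = 1..n. (-1) ^ n * (real (fib i) / real (n - i + 1))
      - 2 * ((-1) ^ i * real (fib i) / real (n - i + 1)))"
    by (rule sum.mono_neutral_right) (auto simp: not_le)
  also have "\<dots> = (\<Sum>i = 1..n. real (fib i) * ((-1) ^ n + 2 * (-1) ^ (i - 1)) / real (n - i + 1))"
  proof (rule sum.cong)
    fix i assume "i \<in> {1..n}"
    then obtain j where "i = Suc j"
      by (cases i) auto
    then show "(-1) ^ n * (real (fib i) / real (n - i + 1))
        - 2 * ((-1) ^ i * real (fib i) / real (n - i + 1))
      = real (fib i) * ((-1) ^ n + 2 * (-1) ^ (i - 1)) / real (n - i + 1)"
      by (simp add: add_divide_distrib algebra_simps)
  qed simp
  finally show ?thesis .
qed

end
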